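(* Suppose that one of the following two conditions is satisfied: (C1) $\boldsymbol a\cdot\nabla(\bar v+v')\in\mathcal V'_{disc}$ for every $(\bar v,v')\in\boldsymbol{\mathcal V}^h=\overline{\mathcal V}\times\mathcal V'_{disc}$; (C2) $\boldsymbol a\cdot\nabla\bar v\in\mathcal V'_{disc}$ for every $\bar v\in\overline{\mathcal V}$, and on each element $\Omega_K$ the artificial diffusivity is $$\kappa_{art}=C_{art}\left(\max\left\{\frac{\|\boldsymbol a\|_{0,\infty,\Omega_K}}{h_K},\frac{C_{inv}\kappa}{h_K^2}\right\}\right)^{-1}\|\boldsymbol a\|^2_{0,\infty,\Omega_K}$$ with a constant $C_{art}>0$, where $C_{inv}>0$ is a constant such that for every $\bar v\in\overline{\mathcal V}$, $v'\in\mathcal V'_{disc}$ and $\Omega_K\in\mathcal M$, each $w\in\{\bar v,v'\}$ satisfies $|w|^2_{1,\Omega_K}\le\frac{C_{inv}}{h_K^2}\|w\|^2_{0,\Omega_K}$ and $\|\Delta w\|^2_{0,\Omega_K}\le\frac{C_{inv}}{h_K^2}|w|^2_{1,\Omega_K}$. Then there is a constant $C_{SUPG}>0$, independent of $\boldsymbol a$, $\kappa$ and the mesh size $h=\max_Kh_K$, such that for every $(\bar v,v')\in\boldsymbol{\mathcal V}^h$ and every element $\Omega_K\in\mathcal M$, $$\|\tau_K^{1/2}\boldsymbol a\cdot\nabla(\bar v+v')\|^2_{0,\Omega_K}\le C_{SUPG}\left(\kappa_{art}|v'|^2_{1,\Omega_K}+\|\tau_K^{1/2}\mathcal P'_K(\boldsymbol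 a\cdot\nabla(\bar v+v'))\|^2_{0,\Omega_K}\right).$$
   Context: Setting. $\Omega\subset\mathbb R^d$ ($d\in\{2,3\}$) is a bounded polygonal/polyhedral domain, partitioned by a conforming mesh $\mathcal M=\{\Omega_K\}_{K=1}^{n_{el}}$ of simplices or of parallelotopes (affine images of a reference element); $h_K$ is the size (e.g. diameter) of $\Omega_K$. $\boldsymbol a:\Omega\to\mathbb R^d$ is a smooth (up to the boundary) divergence-free velocity field, $\kappa>0$ is a constant diffusivity, and $\kappa_{art}\ge0$ is an artificial diffusivity, constant on each element. Spaces. $\overline{\mathcal V}\subset H^1_0(\Omega)$ is the space of continuous functions vanishing on $\partial\Omega$ whose restriction to each element is a polynomial of degree $p\ge1$ (simplices) or (the affine image of) a tensor-product polynomial of degree $p$ (parallelotopes). $\mathcal V'_{disc}\subset L^2(\Omega)$ is the space of functions, with no inter-element continuity and no boundary conditions, whose restriction to each element is a polynomial (resp. tensor-product polynomial) of degree $p_f$; $\mathcal V'_{disc,K}$ is the space of its restrictions to $\Omega_K$, and $\mathcal P'_K$ is the $L^2(\Omega_K)$-orthogonal projector onto $\mathcal V'_{disc,K}$. Gradients of elements of $\mathcal V'_{disc}$ are taken element by element. Norms. $\|\cdot\|_{0,D}$ is the $L^2(D)$ norm, $|v|_{1,D}=\|\nabla v\|_{L^2(D)}$, and $\|\boldsymbol a\|_{0,\infty,D}=\operatorname{ess\,sup}_D|\boldsymbol a|$. Moreover $$\tau_K=C_\tau\left(\max\left\{\frac{\|\boldsymbol a\|_{0,\infty,\Omega_K}}{h_K},\frac{C_{inv}\kappa}{h_K^2}\right\}\right)^{-1},$$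 where $C_\tau>0$ is an arbitrary positive constant and $C_{inv}>0$ is the constant of the inverse inequalities stated in (C2). Convention on constants. "Independent of $\boldsymbol a$, $\kappa$ and $h$" means that the constant may depend only on the fixed data $\Omega$, $d$, $p$, $p_f$, the mesh (shape) regularity, and the constants $C_{inv},C_{art},C_\tau$. *)

theory Defs
  imports "HOL-Analysis.Analysis" "HOL-Probability.Essential_Supremum"
begin

subsection \<open>Differential operators and norms\<close>

definition grad :: "(real^'n \<Rightarrow> real) \<Rightarrow> real^'n \<Rightarrow> real^'n" where
  "grad f x = (\<chi> i. frechet_derivative f (at x) (axis i 1))"

definition divergence :: "(real^'n \<Rightarrow> real^'n) \<Rightarrow> real^'n \<Rightarrow> real" where
  "divergence u x = (\<Sum>i\<in>UNIV. frechet_derivative u (at x) (axis i 1) $ i)"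

definition laplacian :: "(real^'n \<Rightarrow> real) \<Rightarrow> real^'n \<Rightarrow> real" where
  "laplacian f = divergence (grad f)"

definition norm_L2 :: "(real^'n) set \<Rightarrow> (real^'n \<Rightarrow> 'b::real_normed_vector) \<Rightarrow> real" where
  "norm_L2 D f = sqrt (LINT x:D|lebesgue. (norm (f x))\<^sup>2)"

definition seminorm_H1 :: "(real^'n) set \<Rightarrow> (real^'n \<Rightarrow> real) \<Rightarrow> real" where
  "seminorm_H1 D v = norm_L2 D (grad v)"

definition norm_Linf :: "(real^'n) set \<Rightarrow> (real^'n \<Rightarrow> real^'n) \<Rightarrow> real" where
  "norm_Linf D a = real_of_ereal (esssup (lebesgue_on D) (\<lambda>x. ereal (norm (a x))))"

text \<open>The \<open>L\<^sup>2(D)\<close>-orthogonal projection of \<open>f\<close> onto a space \<open>W\<close> of functions on \<open>D\<close>.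
  As functions are total, its values outside \<open>D\<close> are unspecified; only its values on \<open>D\<close> are
  ever used.\<close>

definition L2_projection ::
  "(real^'n) set \<Rightarrow> (real^'n \<Rightarrow> real) set \<Rightarrow> (real^'n \<Rightarrow> real) \<Rightarrow> (real^'n \<Rightarrow> real)" where
  "L2_projection D W f =
    (SOME g. g \<in> W \<and> (\<forall>w\<in>W. (LINT x:D|lebesgue. (f x - g x) * w x) = 0))"

text \<open>\<open>C\<^sup>\<infinity>\<close> up to the boundary: the partial derivatives of all orders (\<open>D js\<close> is the one with
  respect to the coordinates in \<open>js\<close>) exist in \<open>\<Omega>\<close> and extend continuously to its closure.\<close>

definition smooth_upto_boundary :: "(real^'n) set \<Rightarrow> (real^'n \<Rightarrow> real^'n) \<Rightarrow> bool" where
  "smooth_upto_boundary \<Omega> f \<longleftrightarrow>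
    (\<exists>D :: 'n list \<Rightarrow> real^'n \<Rightarrow> real^'n.
      (\<forall>x\<in>\<Omega>. D [] x = f x) \<and>
      (\<forall>js. continuous_on (closure \<Omega>) (D js) \<and>
        (\<forall>x\<in>\<Omega>. (D js has_derivative (\<lambda>v. \<Sum>j\<in>UNIV. (v $ j) *\<^sub>R D (j # js) x)) (at x))))"


subsection \<open>Domain and mesh\<close>

definition polyhedral_domain :: "(real^'n) set \<Rightarrow> bool" where
  "polyhedral_domain \<Omega> \<longleftrightarrow>
    \<Omega> \<noteq> {} \<and> open \<Omega> \<and> connected \<Omega> \<and> bounded \<Omega> \<and>
    (\<exists>\<F>. finite \<F> \<and> (\<forall>P\<in>\<F>. polytope P \<and> aff_dim P = int CARD('n) - 1) \<and>
      frontier \<Omega> = \<Union>\<F>)"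

datatype cell = Simplex | Parallelotope

text \<open>Elements are open sets, so that gradients of elementwise polynomials are
  ordinary gradients at each of their points.\<close>

definition ref_elem :: "cell \<Rightarrow> (real^'n) set" where
  "ref_elem c = (case c of
      Simplex \<Rightarrow> {x. (\<forall>i. 0 < x $ i) \<and> (\<Sum>i\<in>UNIV. x $ i) < 1}
    | Parallelotope \<Rightarrow> {x. \<forall>i. 0 < x $ i \<and> x $ i < 1})"

definition affine_iso :: "(real^'n \<Rightarrow> real^'n) \<Rightarrow> bool" where
  "affine_iso G \<longleftrightarrow> (\<exists>A b. invertible A \<and> (\<forall>x. G x = A *v x + b))"

text \<open>A mesh with elements \<open>\<Omega>\<^sub>1, \<dots>, \<Omega>\<^sub>N\<close> is given by the affine maps \<open>F K\<close> from the
  reference element onto \<open>\<Omega>\<^sub>K\<close>.\<close>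

definition elem :: "cell \<Rightarrow> (nat \<Rightarrow> real^'n \<Rightarrow> real^'n) \<Rightarrow> nat \<Rightarrow> (real^'n) set" where
  "elem c F K = F K ` ref_elem c"

definition conforming_mesh ::
  "cell \<Rightarrow> (real^'n) set \<Rightarrow> nat \<Rightarrow> (nat \<Rightarrow> real^'n \<Rightarrow> real^'n) \<Rightarrow> bool" where
  "conforming_mesh c \<Omega> N F \<longleftrightarrow>
    (\<forall>K\<in>{1..N}. affine_iso (F K) \<and> elem c F K \<subseteq> \<Omega>) \<and>
    (\<Union>K\<in>{1..N}. closure (elem c F K)) = closure \<Omega> \<and>
    (\<forall>K\<in>{1..N}. \<forall>L\<in>{1..N}. K \<noteq> L \<longrightarrow>
      elem c F K \<inter> elem c F L = {} \<and>
      (closure (elem c F K) \<inter> closure (elem c F L)) face_of closure (elem c F K) \<and>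
      (closure (elem c F K) \<inter> closure (elem c F L)) face_of closure (elem c F L))"

text \<open>Shape regularity with parameter \<open>\<sigma>\<close>: each element contains a ball of diameter
  \<open>h\<^sub>K / \<sigma>\<close>.\<close>

definition shape_regular ::
  "cell \<Rightarrow> real \<Rightarrow> nat \<Rightarrow> (nat \<Rightarrow> real^'n \<Rightarrow> real^'n) \<Rightarrow> bool" where
  "shape_regular c \<sigma> N F \<longleftrightarrow>
    (\<forall>K\<in>{1..N}. \<exists>x. ball x (diameter (elem c F K) / (2 * \<sigma>)) \<subseteq> elem c F K)"


subsection \<open>Finite element spaces\<close>

definition exponents :: "cell \<Rightarrow> nat \<Rightarrow> ('n::finite \<Rightarrow> nat) set" where
  "exponents c p = (case c of
      Simplex \<Rightarrow> {\<alpha>. (\<Sum>i\<in>UNIV. \<alpha> i) \<le> p}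
    | Parallelotope \<Rightarrow> {\<alpha>. \<forall>i. \<alpha> i \<le> p})"

definition polys :: "cell \<Rightarrow> nat \<Rightarrow> (real^'n \<Rightarrow> real) set" where
  "polys c p =
    {q. \<exists>coef. \<forall>x. q x = (\<Sum>\<alpha>\<in>exponents c p. coef \<alpha> * (\<Prod>i\<in>UNIV. (x $ i) ^ \<alpha> i))}"

text \<open>Polynomials on the image of the reference element under \<open>G\<close>; on parallelotopes these are
  tensor-product polynomials in the reference coordinates.\<close>

definition local_space ::
  "cell \<Rightarrow> (real^'n \<Rightarrow> real^'n) \<Rightarrow> nat \<Rightarrow> (real^'n \<Rightarrow> real) set" where
  "local_space c G p = (case c of
      Simplex \<Rightarrow> {v. \<exists>q\<in>polys c p. \<forall>x\<in>G ` ref_elem c. v x = q x}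
    | Parallelotope \<Rightarrow> {v. \<exists>q\<in>polys c p. \<forall>y\<in>ref_elem c. v (G y) = q y})"

definition V_bar ::
  "cell \<Rightarrow> (real^'n) set \<Rightarrow> nat \<Rightarrow> (nat \<Rightarrow> real^'n \<Rightarrow> real^'n) \<Rightarrow> nat \<Rightarrow> (real^'n \<Rightarrow> real) set" where
  "V_bar c \<Omega> N F p =
    {v. continuous_on (closure \<Omega>) v \<and> (\<forall>x\<in>frontier \<Omega>. v x = 0) \<and>
        (\<forall>K\<in>{1..N}. v \<in> local_space c (F K) p)}"

text \<open>Functions in \<open>V_disc\<close> are only constrained on the open elements; their values on the
  element boundaries (a null set) are irrelevant.\<close>

definition V_disc ::
  "cell \<Rightarrow> nat \<Rightarrow> (nat \<Rightarrow> real^'n \<Rightarrow> real^'n) \<Rightarrow> nat \<Rightarrow> (real^'n \<Rightarrow> real) set" where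
  "V_disc c N F pf = {v. \<forall>K\<in>{1..N}. v \<in> local_space c (F K) pf}"

definition proj_disc ::
  "cell \<Rightarrow> (nat \<Rightarrow> real^'n \<Rightarrow> real^'n) \<Rightarrow> nat \<Rightarrow> nat \<Rightarrow> (real^'n \<Rightarrow> real) \<Rightarrow> (real^'n \<Rightarrow> real)" where
  "proj_disc c F pf K = L2_projection (elem c F K) (local_space c (F K) pf)"

definition convective_deriv ::
  "(real^'n \<Rightarrow> real^'n) \<Rightarrow> (real^'n \<Rightarrow> real) \<Rightarrow> real^'n \<Rightarrow> real" where
  "convective_deriv a v x = a x \<bullet> grad v x"


subsection \<open>Stabilization parameters and inverse inequalities\<close>

text \<open>In the next two definitions \<open>D\<close> is the element \<open>\<Omega>\<^sub>K\<close>, of size \<open>h\<^sub>K = diameter D\<close>.\<close>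

definition rate :: "real \<Rightarrow> real \<Rightarrow> (real^'n \<Rightarrow> real^'n) \<Rightarrow> (real^'n) set \<Rightarrow> real" where
  "rate Cinv \<kappa> a D = max (norm_Linf D a / diameter D) (Cinv * \<kappa> / (diameter D)\<^sup>2)"

definition tau ::
  "real \<Rightarrow> real \<Rightarrow> real \<Rightarrow> (real^'n \<Rightarrow> real^'n) \<Rightarrow> (real^'n) set \<Rightarrow> real" where
  "tau C\<tau> Cinv \<kappa> a D = C\<tau> * inverse (rate Cinv \<kappa> a D)"

definition inverse_inequalities :: "real \<Rightarrow> (real^'n) set \<Rightarrow> (real^'n \<Rightarrow> real) \<Rightarrow> bool" where
  "inverse_inequalities Cinv D w \<longleftrightarrow>
    (seminorm_H1 D w)\<^sup>2 \<le> Cinv / (diameter D)\<^sup>2 * (norm_L2 D w)\<^sup>2 \<and>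
    (norm_L2 D (laplacian w))\<^sup>2 \<le> Cinv / (diameter D)\<^sup>2 * (seminorm_H1 D w)\<^sup>2"

end

theory Submission
  imports Defs
begin

text \<open>Fix an element \<open>D\<close>, let \<open>W\<close> be the local space of degree \<open>pf\<close> on it, \<open>P\<close> the orthogonal
  projector onto \<open>W\<close> and \<open>f = a \<bullet> \<nabla>(vb + v')\<close>.  By Pythagoras
  \<open>\<parallel>f\<parallel>\<^sup>2 = \<parallel>f - P f\<parallel>\<^sup>2 + \<parallel>P f\<parallel>\<^sup>2\<close>, and \<open>P f\<close> is the best approximation of \<open>f\<close>, so that
  \<open>\<parallel>f\<parallel>\<^sup>2 \<le> \<parallel>f - z\<parallel>\<^sup>2 + \<parallel>P f\<parallel>\<^sup>2\<close> for every \<open>z\<close> in \<open>W\<close> (\<open>norm_L2_le_proj_disc\<close>).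

  Both conditions of the theorem supply a good \<open>z\<close>.  If \<open>f\<close> itself lies in \<open>W\<close>, then \<open>z = f\<close>
  makes the first term vanish.  If only \<open>a \<bullet> \<nabla>vb\<close> lies in \<open>W\<close>, then this choice leaves
  \<open>f - z = a \<bullet> \<nabla>v'\<close>, which is at most \<open>\<parallel>a\<parallel>\<^sub>\<infinity> |v'|\<^sub>1\<close> (\<open>norm_L2_convective_deriv_le\<close>); since
  \<open>\<tau>\<close> and the prescribed artificial diffusivity contain the same factor \<open>inverse (rate \<dots>)\<close>,
  \<open>\<tau> \<parallel>a\<parallel>\<^sub>\<infinity>\<^sup>2\<close> is exactly \<open>C\<tau> / Cart\<close> times that diffusivity.  Hence \<open>max 1 (C\<tau> / Cart)\<close> serves
  in both cases.

  The work lies in the analytic side conditions.  The projection is specified by a choice operator,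
  so it has the projection property only once some projection is known to exist; this is shown by a
  Gram--Schmidt argument (\<open>exists_orthogonal_coefficients\<close>).  And the integrals, which would be
  \<open>0\<close> by convention for functions that are not integrable, carry information only because all
  functions in play agree on the bounded set \<open>D\<close> with functions continuous on its closure
  (\<open>square_integrable_lebesgue_on\<close>, \<open>local_space_continuous_grad\<close>).\<close>

section \<open>Square-integrable functions\<close>

definition square_integrable :: "'a measure \<Rightarrow> ('a \<Rightarrow> real) \<Rightarrow> bool" where
  "square_integrable M f \<longleftrightarrow> f \<in> borel_measurable M \<and> integrable M (\<lambda>x. (f x)\<^sup>2)"

lemma square_integrable_mult:
  assumes "square_integrable M f" "square_integrable M g"
  shows "integrable M (\<lambda>x. f x * g x)"
proof (rule Bochner_Integration.integrable_bound)
  show "integrable M (\<lambda>x. (f x)\<^sup>2 + (g x)\<^sup>2)"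
    using assms by (auto simp: square_integrable_def)
  show "(\<lambda>x. f x * g x) \<in> borel_measurable M"
    using assms by (auto simp: square_integrable_def)
  have "\<bar>u * v\<bar> \<le> u\<^sup>2 + v\<^sup>2" for u v :: real
  proof -
    have "2 * (\<bar>u\<bar> * \<bar>v\<bar>) \<le> u\<^sup>2 + v\<^sup>2"
      using sum_squares_bound[of "\<bar>u\<bar>" "\<bar>v\<bar>"] by simp
    moreover have "0 \<le> \<bar>u\<bar> * \<bar>v\<bar>" by simp
    ultimately show ?thesis unfolding abs_mult by linarith
  qed
  then show "AE x in M. norm (f x * g x) \<le> norm ((f x)\<^sup>2 + (g x)\<^sup>2)"
    by simp
qed

lemma square_integrable_scale:
  "square_integrable M f \<Longrightarrow> square_integrable M (\<lambda>x. k * f x)"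
  by (auto simp: square_integrable_def power_mult_distrib)

lemma square_integrable_add:
  assumes "square_integrable M f" "square_integrable M g"
  shows "square_integrable M (\<lambda>x. f x + g x)"
  using assms square_integrable_mult[OF assms]
  by (auto simp: square_integrable_def power2_sum mult.assoc)

lemma square_integrable_diff:
  assumes "square_integrable M f" "square_integrable M g"
  shows "square_integrable M (\<lambda>x. f x - g x)"
  using square_integrable_add[OF assms(1) square_integrable_scale[OF assms(2), of "-1"]] by simp

lemma integral_mult_eq_0_if_norm_0:
  assumes f: "square_integrable M f" and g: "g \<in> borel_measurable M"
    and "(\<integral>x. (f x)\<^sup>2 \<partial>M) = 0"
  shows "(\<integral>x. g x * f x \<partial>M) = 0"
proof -
  have "AE x in M. (f x)\<^sup>2 = 0"
    using f assms(3) integral_nonneg_eq_0_iff_AE[of M "\<lambda>x. (f x)\<^sup>2"]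
    by (auto simp: square_integrable_def)
  then have "AE x in M. g x * f x = 0" by eventually_elim simp
  then show ?thesis by (rule integral_eq_zero_AE)
qed

section \<open>Orthogonal projection onto a finite-dimensional space\<close>

text \<open>The values outside \<open>D\<close> are left free, as they are in the local finite element spaces, so that
  those spaces are instances; the set is then not the linear span of the \<open>b i\<close> as total functions.\<close>

definition functions_spanned_on :: "'a set \<Rightarrow> 'i set \<Rightarrow> ('i \<Rightarrow> 'a \<Rightarrow> real) \<Rightarrow> ('a \<Rightarrow> real) set" where
  "functions_spanned_on D I b = {v. \<exists>c. \<forall>x\<in>D. v x = (\<Sum>i\<in>I. c i * b i x)}"

lemma functions_spanned_on_diff:
  assumes "v \<in> functions_spanned_on D I b" "w \<in> functions_spanned_on D I b"
  shows "(\<lambda>x. v x - w x) \<in> functions_spanned_on D I b"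
proof -
  obtain c d where "\<forall>x\<in>D. v x = (\<Sum>i\<in>I. c i * b i x)" "\<forall>x\<in>D. w x = (\<Sum>i\<in>I. d i * b i x)"
    using assms by (auto simp: functions_spanned_on_def)
  then have "\<forall>x\<in>D. v x - w x = (\<Sum>i\<in>I. (c i - d i) * b i x)"
    by (simp add: left_diff_distrib sum_subtractf)
  then show ?thesis unfolding functions_spanned_on_def by (intro CollectI exI[of _ "\<lambda>i. c i - d i"])
qed

lemma square_integrable_sum:
  assumes "\<And>i. i \<in> I \<Longrightarrow> square_integrable M (b i)"
  shows "square_integrable M (\<lambda>x. \<Sum>i\<in>I. c i * b i x)"
  using assms
proof (induction I rule: infinite_finite_induct)
  case (insert i I)
  then show ?case by (simp add: square_integrable_add square_integrable_scale)
qed (simp_all add: square_integrable_def)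

lemma square_integrable_cong:
  assumes "square_integrable M f" "\<And>x. x \<in> space M \<Longrightarrow> g x = f x"
  shows "square_integrable M g"
proof -
  have "g \<in> borel_measurable M \<longleftrightarrow> f \<in> borel_measurable M"
    by (rule measurable_cong) (use assms in auto)
  moreover have "integrable M (\<lambda>x. (g x)\<^sup>2) \<longleftrightarrow> integrable M (\<lambda>x. (f x)\<^sup>2)"
    by (rule Bochner_Integration.integrable_cong) (use assms in auto)
  ultimately show ?thesis using assms by (simp add: square_integrable_def)
qed

lemma square_integrable_spanned:
  assumes "\<And>i. i \<in> I \<Longrightarrow> square_integrable M (b i)"
    and "w \<in> functions_spanned_on (space M) I b"
  shows "square_integrable M w"
proof -
  obtain c where c: "\<And>x. x \<in> space M \<Longrightarrow> w x = (\<Sum>i\<in>I. c i * b i x)"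
    using assms(2) by (auto simp: functions_spanned_on_def)
  have "square_integrable M (\<lambda>x. \<Sum>i\<in>I. c i * b i x)"
    using assms(1) by (rule square_integrable_sum)
  then show ?thesis by (rule square_integrable_cong) (rule c)
qed

lemma integral_diff_mult:
  assumes "square_integrable M f" "square_integrable M g" "square_integrable M h"
  shows "(\<integral>x. (f x - g x) * h x \<partial>M) = (\<integral>x. f x * h x \<partial>M) - (\<integral>x. g x * h x \<partial>M)"
  using assms by (simp add: left_diff_distrib square_integrable_mult)

text \<open>Gram--Schmidt, carried out with coefficients.  The family need not be linearly independent:
  if the part \<open>e\<close> of the new function \<open>b j\<close> that is orthogonal to the old ones has norm \<open>0\<close>, then
  every function is orthogonal to it and no correction is needed.\<close>

lemma exists_orthogonal_coefficients:
  assumes "finite I" "\<And>i. i \<in> I \<Longrightarrow> square_integrable M (b i)" "square_integrable M f"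
  shows "\<exists>c. \<forall>i\<in>I. (\<integral>x. (f x - (\<Sum>k\<in>I. c k * b k x)) * b i x \<partial>M) = 0"
  using assms
proof (induction I arbitrary: f rule: finite_induct)
  case empty
  then show ?case by simp
next
  case (insert j I)
  note sq = square_integrable_diff square_integrable_scale square_integrable_sum
  have b: "\<And>i. i \<in> I \<Longrightarrow> square_integrable M (b i)" and bj: "square_integrable M (b j)"
    using insert.prems by auto
  note f = insert.prems(2)
  obtain d where d: "\<And>i. i \<in> I \<Longrightarrow> (\<integral>x. (b j x - (\<Sum>k\<in>I. d k * b k x)) * b i x \<partial>M) = 0"
    using insert.IH[OF b bj] by blast
  obtain c where c: "\<And>i. i \<in> I \<Longrightarrow> (\<integral>x. (f x - (\<Sum>k\<in>I. c k * b k x)) * b i x \<partial>M) = 0"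
    using insert.IH[OF b f] by blast
  define e where "e = (\<lambda>x. b j x - (\<Sum>k\<in>I. d k * b k x))"
  define r where "r = (\<lambda>x. f x - (\<Sum>k\<in>I. c k * b k x))"
  have e: "square_integrable M e" and r: "square_integrable M r"
    unfolding e_def r_def using b bj f by (intro sq; simp)+
  \<comment> \<open>If \<open>e\<close> has norm \<open>0\<close>, division by zero gives \<open>k = 0\<close>, and \<open>k\<close> below still holds.\<close>
  define k where "k = (\<integral>x. r x * e x \<partial>M) / (\<integral>x. e x * e x \<partial>M)"
  have k: "k * (\<integral>x. e x * e x \<partial>M) = (\<integral>x. r x * e x \<partial>M)"
    using integral_mult_eq_0_if_norm_0[OF e, of r] r
    by (auto simp: k_def power2_eq_square square_integrable_def)
  define s where "s = (\<lambda>x. r x - k * e x)"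
  have s: "square_integrable M s"
    unfolding s_def using e r by (intro sq)
  have s_mult: "(\<integral>x. s x * h x \<partial>M) = (\<integral>x. r x * h x \<partial>M) - k * (\<integral>x. e x * h x \<partial>M)"
    if "square_integrable M h" for h
    using integral_diff_mult[OF r square_integrable_scale[OF e] that, of k]
    by (simp add: s_def mult.assoc)
  have s_b: "(\<integral>x. s x * b i x \<partial>M) = 0" if "i \<in> I" for i
    using s_mult[OF b[OF that]] c[OF that] d[OF that] by (simp add: r_def e_def)
  have s_e: "(\<integral>x. s x * e x \<partial>M) = 0"
    using s_mult[OF e] k by simp
  have "(\<integral>x. s x * (\<Sum>k\<in>I. d k * b k x) \<partial>M) = (\<integral>x. (\<Sum>k\<in>I. d k * (s x * b k x)) \<partial>M)"
    by (simp add: sum_distrib_left mult_ac)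
  also have "\<dots> = (\<Sum>k\<in>I. d k * (\<integral>x. s x * b k x \<partial>M))"
    using s b square_integrable_mult by (subst Bochner_Integration.integral_sum) auto
  also have "\<dots> = 0" using s_b by simp
  finally have s_sum: "(\<integral>x. s x * (\<Sum>k\<in>I. d k * b k x) \<partial>M) = 0" .
  have sums: "square_integrable M (\<lambda>x. \<Sum>k\<in>I. d k * b k x)"
    using b by (intro sq)
  have "(\<integral>x. s x * b j x \<partial>M) = (\<integral>x. s x * e x + s x * (\<Sum>k\<in>I. d k * b k x) \<partial>M)"
    by (simp add: e_def algebra_simps)
  also have "\<dots> = 0"
    using s e sums s_e s_sum square_integrable_mult by (subst Bochner_Integration.integral_add) auto
  finally have s_bj: "(\<integral>x. s x * b j x \<partial>M) = 0" .
  define c' where "c' = (\<lambda>i. if i = j then k else c i - k * d i)"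
  have "(\<Sum>i\<in>I. c' i * b i x) = (\<Sum>i\<in>I. c i * b i x) - k * (\<Sum>i\<in>I. d i * b i x)" for x
  proof -
    have "(\<Sum>i\<in>I. c' i * b i x) = (\<Sum>i\<in>I. c i * b i x - k * (d i * b i x))"
      using insert.hyps(2) by (intro sum.cong) (auto simp: c'_def algebra_simps)
    then show ?thesis by (simp add: sum_subtractf sum_distrib_left)
  qed
  moreover have "c' j = k" by (simp add: c'_def)
  ultimately have s_eq: "f x - (\<Sum>i\<in>insert j I. c' i * b i x) = s x" for x
    using insert.hyps by (simp add: s_def r_def e_def algebra_simps)
  show ?case
  proof (intro exI[of _ c'] ballI)
    fix i assume "i \<in> insert j I"
    then have "(\<integral>x. s x * b i x \<partial>M) = 0" using s_b s_bj by blast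
    then show "(\<integral>x. (f x - (\<Sum>k\<in>insert j I. c' k * b k x)) * b i x \<partial>M) = 0"
      unfolding s_eq .
  qed
qed

text \<open>Applied with \<open>v = g\<close> and with \<open>v = g - w\<close>, Pythagoras expresses the norms of \<open>f\<close> and of
  \<open>f - w\<close> through the same term, the norm of \<open>f - g\<close>.\<close>

lemma orthogonal_projection_bound:
  assumes b: "\<And>i. i \<in> I \<Longrightarrow> square_integrable M (b i)" and f: "square_integrable M f"
    and gW: "g \<in> functions_spanned_on (space M) I b"
    and orth: "\<And>w. w \<in> functions_spanned_on (space M) I b \<Longrightarrow> (\<integral>x. (f x - g x) * w x \<partial>M) = 0"
    and wW: "w \<in> functions_spanned_on (space M) I b"
  shows "(\<integral>x. (f x)\<^sup>2 \<partial>M) \<le> (\<integral>x. (f x - w x)\<^sup>2 \<partial>M) + (\<integral>x. (g x)\<^sup>2 \<partial>M)"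
proof -
  have pyth: "(\<integral>x. (f x - g x + v x)\<^sup>2 \<partial>M) = (\<integral>x. (f x - g x)\<^sup>2 \<partial>M) + (\<integral>x. (v x)\<^sup>2 \<partial>M)"
    if v: "v \<in> functions_spanned_on (space M) I b" for v
  proof -
    have sv: "square_integrable M v"
      by (rule square_integrable_spanned[OF _ v]) (rule b)
    have sg: "square_integrable M g"
      by (rule square_integrable_spanned[OF _ gW]) (rule b)
    note sr = square_integrable_diff[OF f sg]
    have "(\<integral>x. (f x - g x + v x)\<^sup>2 \<partial>M)
        = (\<integral>x. (f x - g x)\<^sup>2 + (v x)\<^sup>2 + 2 * ((f x - g x) * v x) \<partial>M)"
      by (simp only: power2_sum mult.assoc)
    also have "\<dots> = (\<integral>x. (f x - g x)\<^sup>2 \<partial>M) + (\<integral>x. (v x)\<^sup>2 \<partial>M)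
        + 2 * (\<integral>x. (f x - g x) * v x \<partial>M)"
      using sr sv square_integrable_mult[OF sr sv] by (simp add: square_integrable_def)
    finally show ?thesis using orth[OF v] by simp
  qed
  have "(\<integral>x. (f x)\<^sup>2 \<partial>M) = (\<integral>x. (f x - g x)\<^sup>2 \<partial>M) + (\<integral>x. (g x)\<^sup>2 \<partial>M)"
    using pyth[OF gW] by simp
  moreover have "(\<integral>x. (f x - w x)\<^sup>2 \<partial>M)
      = (\<integral>x. (f x - g x)\<^sup>2 \<partial>M) + (\<integral>x. (g x - w x)\<^sup>2 \<partial>M)"
    using pyth[OF functions_spanned_on_diff[OF gW wW]] by simp
  moreover have "0 \<le> (\<integral>x. (g x - w x)\<^sup>2 \<partial>M)" by simp
  ultimately show ?thesis by linarith
qed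

section \<open>Norms and projections on a subset of Euclidean space\<close>

lemma set_integral_lebesgue_on:
  fixes f :: "'a::euclidean_space \<Rightarrow> real"
  assumes "D \<in> sets lebesgue"
  shows "(LINT x:D|lebesgue. f x) = (\<integral>x. f x \<partial>lebesgue_on D)"
  using assms by (simp add: set_lebesgue_integral_def integral_restrict_space)

lemma norm_L2_power2:
  assumes "D \<in> sets lebesgue"
  shows "(norm_L2 D f)\<^sup>2 = (\<integral>x. (norm (f x))\<^sup>2 \<partial>lebesgue_on D)"
  using assms by (simp add: norm_L2_def set_integral_lebesgue_on)

lemma norm_L2_le_L2_projection:
  fixes b :: "'i \<Rightarrow> real^'n \<Rightarrow> real"
  assumes D: "D \<in> sets lebesgue" and I: "finite I"
    and b: "\<And>i. i \<in> I \<Longrightarrow> square_integrable (lebesgue_on D) (b i)"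
    and W: "W = functions_spanned_on D I b"
    and f: "square_integrable (lebesgue_on D) f" and w: "w \<in> W"
  shows "(norm_L2 D f)\<^sup>2 \<le> (norm_L2 D (\<lambda>x. f x - w x))\<^sup>2 + (norm_L2 D (L2_projection D W f))\<^sup>2"
proof -
  define M where "M = lebesgue_on D"
  have space: "space M = D" by (simp add: M_def)
  note b = b[folded M_def] and f = f[folded M_def]
  define P where "P = (\<lambda>g. g \<in> W \<and> (\<forall>w\<in>W. (LINT x:D|lebesgue. (f x - g x) * w x) = 0))"
  obtain c where c: "\<And>i. i \<in> I \<Longrightarrow> (\<integral>x. (f x - (\<Sum>k\<in>I. c k * b k x)) * b i x \<partial>M) = 0"
    using exists_orthogonal_coefficients[OF I, of M b f] b f by blast
  define g where "g = (\<lambda>x. \<Sum>k\<in>I. c k * b k x)"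
  have sg: "square_integrable M g" unfolding g_def using b by (rule square_integrable_sum)
  have "(\<integral>x. (f x - g x) * v x \<partial>M) = 0" if "v \<in> W" for v
  proof -
    obtain d where d: "\<And>x. x \<in> D \<Longrightarrow> v x = (\<Sum>i\<in>I. d i * b i x)"
      using \<open>v \<in> W\<close> by (auto simp: W functions_spanned_on_def)
    have "(\<integral>x. (f x - g x) * v x \<partial>M) = (\<integral>x. (\<Sum>i\<in>I. d i * ((f x - g x) * b i x)) \<partial>M)"
      by (rule Bochner_Integration.integral_cong) (auto simp: space d sum_distrib_left mult_ac)
    also have "\<dots> = (\<Sum>i\<in>I. d i * (\<integral>x. (f x - g x) * b i x \<partial>M))"
      using b square_integrable_mult[OF square_integrable_diff[OF f sg]]
      by (subst Bochner_Integration.integral_sum) auto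
    also have "\<dots> = 0" using c by (simp add: g_def)
    finally show ?thesis .
  qed
  moreover have "g \<in> W" by (auto simp: W functions_spanned_on_def g_def)
  ultimately have "P g" by (simp add: P_def M_def set_integral_lebesgue_on[OF D])
  then have "P (L2_projection D W f)"
    unfolding L2_projection_def P_def[symmetric] by (rule someI[of P])
  then have "L2_projection D W f \<in> functions_spanned_on (space M) I b"
    and "\<And>v. v \<in> functions_spanned_on (space M) I b
      \<Longrightarrow> (\<integral>x. (f x - L2_projection D W f x) * v x \<partial>M) = 0"
    unfolding P_def set_integral_lebesgue_on[OF D] M_def[symmetric] space W[symmetric] by auto
  moreover have "w \<in> functions_spanned_on (space M) I b" using w by (simp add: space W)
  ultimately have "(\<integral>x. (f x)\<^sup>2 \<partial>M)
      \<le> (\<integral>x. (f x - w x)\<^sup>2 \<partial>M) + (\<integral>x. (L2_projection D W f x)\<^sup>2 \<partial>M)"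
    using orthogonal_projection_bound[of I M b f "L2_projection D W f" w] b f by simp
  then show ?thesis by (simp add: norm_L2_power2[OF D] M_def)
qed

text \<open>The two functions are kept apart because those of interest, such as gradients of elementwise
  polynomials, are well behaved only inside \<open>D\<close>, whereas boundedness comes from a function that is
  continuous on the compact closure.\<close>

lemma square_integrable_lebesgue_on:
  fixes f g :: "real^'n \<Rightarrow> real"
  assumes D: "open D" "bounded D" and g: "continuous_on (closure D) g"
    and fg: "\<And>x. x \<in> D \<Longrightarrow> f x = g x"
  shows "square_integrable (lebesgue_on D) f"
proof -
  have Dm: "D \<in> lmeasurable" using D by (simp add: lmeasurable_open)
  have gD: "continuous_on D g" using g closure_subset by (rule continuous_on_subset)
  have "bounded (g ` closure D)"
    using g D by (simp add: compact_continuous_image compact_imp_bounded)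
  then obtain B where B: "\<And>x. x \<in> closure D \<Longrightarrow> \<bar>g x\<bar> \<le> B"
    by (auto simp: bounded_iff)
  interpret finite_measure "lebesgue_on D"
    using Dm by (rule finite_measure_lebesgue_on)
  have gm: "g \<in> borel_measurable (lebesgue_on D)"
    using gD Dm by (simp add: continuous_imp_measurable_on_sets_lebesgue fmeasurableD)
  have "integrable (lebesgue_on D) (\<lambda>x. (g x)\<^sup>2)"
  proof (rule integrable_const_bound)
    show "AE x in lebesgue_on D. norm ((g x)\<^sup>2) \<le> B\<^sup>2"
    proof (rule AE_I2)
      fix x assume "x \<in> space (lebesgue_on D)"
      then have "x \<in> closure D" using closure_subset[of D] by auto
      then have "\<bar>g x\<bar> \<le> B" by (rule B)
      then have "\<bar>g x\<bar>\<^sup>2 \<le> B\<^sup>2" by (intro power_mono) auto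
      then show "norm ((g x)\<^sup>2) \<le> B\<^sup>2" by simp
    qed
  qed (use gm in simp)
  then have "square_integrable (lebesgue_on D) g" using gm by (simp add: square_integrable_def)
  then show ?thesis by (rule square_integrable_cong) (use fg in auto)
qed

section \<open>Elements and local finite element spaces\<close>

lemma affine_iso_inverse:
  assumes "affine_iso G"
  obtains H where "polynomial_function H" "\<And>y. H (G y) = y" "\<And>x. G (H x) = x"
proof -
  obtain A b where A: "invertible A" and G: "\<And>x. G x = A *v x + b"
    using assms by (auto simp: affine_iso_def)
  obtain A' where A': "A ** A' = mat 1" "A' ** A = mat 1"
    using A by (auto simp: invertible_def)
  have "polynomial_function (\<lambda>x. A' *v x - A' *v b)"
    by (intro polynomial_function_diff polynomial_function_const polynomial_function_bounded_linear)
       (rule matrix_vector_mul_bounded_linear)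
  then show thesis
    by (rule that) (simp_all add: G A' matrix_vector_right_distrib matrix_vector_mult_diff_distrib
        matrix_vector_mul_assoc)
qed

lemma open_ref_elem: "open (ref_elem c :: (real^'n) set)"
proof (cases c)
  case Simplex
  have "ref_elem c = (\<Inter>i. {x :: real^'n. 0 < x $ i}) \<inter> {x. (\<Sum>i\<in>UNIV. x $ i) < 1}"
    by (auto simp: Simplex ref_elem_def)
  also have "open \<dots>"
    by (intro open_Int open_INT open_Collect_less continuous_intros ballI) auto
  finally show ?thesis .
next
  case Parallelotope
  have "ref_elem c = (\<Inter>i. {x :: real^'n. 0 < x $ i} \<inter> {x. x $ i < 1})"
    by (auto simp: Parallelotope ref_elem_def)
  also have "open \<dots>"
    by (intro open_Int open_INT open_Collect_less continuous_intros ballI) auto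
  finally show ?thesis .
qed

lemma open_affine_image_ref_elem:
  fixes G :: "real^'n \<Rightarrow> real^'n"
  assumes "affine_iso G"
  shows "open (G ` ref_elem c)"
proof -
  obtain H where H: "polynomial_function H" "\<And>y. H (G y) = y" "\<And>x. G (H x) = x"
    using affine_iso_inverse[OF assms] by blast
  have "G ` ref_elem c = H -` ref_elem c"
  proof
    show "H -` ref_elem c \<subseteq> G ` ref_elem c"
      using H(3) by (metis image_eqI subsetI vimageE)
  qed (use H(2) in auto)
  moreover have "open (H -` ref_elem c)"
    using open_ref_elem H(1) by (intro open_vimage continuous_on_polymonial_function)
  ultimately show ?thesis by simp
qed

lemma finite_exponents: "finite (exponents c p :: ('n::finite \<Rightarrow> nat) set)"
proof (rule finite_subset)
  show "exponents c p \<subseteq> (UNIV :: 'n set) \<rightarrow>\<^sub>E {..p}"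
  proof
    fix \<alpha> :: "'n \<Rightarrow> nat" assume \<alpha>: "\<alpha> \<in> exponents c p"
    have "\<alpha> i \<le> p" for i
    proof (cases c)
      case Simplex
      have "\<alpha> i \<le> (\<Sum>i\<in>UNIV. \<alpha> i)" by (rule member_le_sum) auto
      with \<alpha> show ?thesis by (simp add: Simplex exponents_def)
    qed (use \<alpha> in \<open>simp add: exponents_def\<close>)
    then show "\<alpha> \<in> UNIV \<rightarrow>\<^sub>E {..p}" by (simp add: PiE_def extensional_def)
  qed
qed (simp add: finite_PiE)

text \<open>The basis consists of the monomials, composed on parallelotopes with the inverse of \<open>G\<close>, which
  takes points to their reference coordinates.  It is the same for all degrees; only the index set
  depends on \<open>p\<close>.\<close>

lemma local_space_eq_functions_spanned_on:
  fixes G :: "real^'n \<Rightarrow> real^'n"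
  assumes "affine_iso G"
  shows "\<exists>b :: ('n \<Rightarrow> nat) \<Rightarrow> real^'n \<Rightarrow> real. (\<forall>\<alpha>. real_polynomial_function (b \<alpha>)) \<and>
    (\<forall>p. local_space c G p = functions_spanned_on (G ` ref_elem c) (exponents c p) b)"
proof -
  define m where "m = (\<lambda>(\<alpha> :: 'n \<Rightarrow> nat) (x :: real^'n). \<Prod>i\<in>UNIV. (x $ i) ^ \<alpha> i)"
  have m: "real_polynomial_function (m \<alpha>)" for \<alpha>
    unfolding m_def
    by (intro real_polynomial_function_prod real_polynomial_function_power
        real_polynomial_function.intros(1) bounded_linear_vec_nth) simp
  have polys: "(\<exists>q\<in>polys c p. \<forall>y\<in>S. u y = q y)
      \<longleftrightarrow> (\<exists>k. \<forall>y\<in>S. u y = (\<Sum>\<alpha>\<in>exponents c p. k \<alpha> * m \<alpha> y))"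
    for S and u :: "real^'n \<Rightarrow> real" and p
  proof
    assume "\<exists>k. \<forall>y\<in>S. u y = (\<Sum>\<alpha>\<in>exponents c p. k \<alpha> * m \<alpha> y)"
    then obtain k where "\<forall>y\<in>S. u y = (\<Sum>\<alpha>\<in>exponents c p. k \<alpha> * m \<alpha> y)" by blast
    moreover have "(\<lambda>y. \<Sum>\<alpha>\<in>exponents c p. k \<alpha> * m \<alpha> y) \<in> polys c p"
      unfolding polys_def m_def by blast
    ultimately show "\<exists>q\<in>polys c p. \<forall>y\<in>S. u y = q y" by (rule bexI)
  next
    assume "\<exists>q\<in>polys c p. \<forall>y\<in>S. u y = q y"
    then obtain q where "q \<in> polys c p" and q: "\<forall>y\<in>S. u y = q y" by blast
    then obtain k where "\<forall>y. q y = (\<Sum>\<alpha>\<in>exponents c p. k \<alpha> * m \<alpha> y)"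
      unfolding polys_def m_def by blast
    with q have "\<forall>y\<in>S. u y = (\<Sum>\<alpha>\<in>exponents c p. k \<alpha> * m \<alpha> y)" by simp
    then show "\<exists>k. \<forall>y\<in>S. u y = (\<Sum>\<alpha>\<in>exponents c p. k \<alpha> * m \<alpha> y)"
      by (intro exI[of _ k])
  qed
  show ?thesis
  proof (cases c)
    case Simplex
    have "local_space c G p = functions_spanned_on (G ` ref_elem c) (exponents c p) m" for p
      unfolding Simplex local_space_def functions_spanned_on_def cell.case polys[unfolded Simplex]
      by (rule refl)
    with m show ?thesis by blast
  next
    case Parallelotope
    obtain H where H: "polynomial_function H" "\<And>y. H (G y) = y" "\<And>x. G (H x) = x"
      using affine_iso_inverse[OF assms] by blast
    have "local_space c G p
        = functions_spanned_on (G ` ref_elem c) (exponents c p) (\<lambda>\<alpha>. m \<alpha> \<circ> H)" for p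
      by (simp add: local_space_def functions_spanned_on_def Parallelotope H(2)
          polys[unfolded Parallelotope])
    with real_polynomial_function_compose[OF H(1) m] show ?thesis
      by (intro exI[of _ "\<lambda>\<alpha>. m \<alpha> \<circ> H"]) simp
  qed
qed

lemma real_polynomial_function_C1:
  assumes "real_polynomial_function g"
  shows "\<exists>g'. (\<forall>x. (g has_derivative g' x) (at x)) \<and> (\<forall>h. continuous_on UNIV (\<lambda>x. g' x h))"
  using assms
proof induction
  case (linear f)
  then show ?case
    by (intro exI[of _ "\<lambda>x. f"]) (auto intro: bounded_linear_imp_has_derivative)
next
  case (const c)
  then show ?case by (intro exI[of _ "\<lambda>x h. 0"]) auto
next
  case (add f g)
  then obtain f' g' where *:
    "\<And>x. (f has_derivative f' x) (at x)" "\<And>h. continuous_on UNIV (\<lambda>x. f' x h)"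
    "\<And>x. (g has_derivative g' x) (at x)" "\<And>h. continuous_on UNIV (\<lambda>x. g' x h)"
    by blast
  show ?case
    by (intro exI[of _ "\<lambda>x h. f' x h + g' x h"] conjI allI has_derivative_add continuous_on_add *)
next
  case (mult f g)
  then obtain f' g' where *:
    "\<And>x. (f has_derivative f' x) (at x)" "\<And>h. continuous_on UNIV (\<lambda>x. f' x h)"
    "\<And>x. (g has_derivative g' x) (at x)" "\<And>h. continuous_on UNIV (\<lambda>x. g' x h)"
    by blast
  have "continuous_on UNIV f" "continuous_on UNIV g"
    using mult.hyps by (simp_all add: continuous_on_polymonial_function real_polynomial_function_eq)
  then show ?case
    by (intro exI[of _ "\<lambda>x h. f x * g' x h + f' x h * g x"] conjI allI has_derivative_mult
        continuous_on_add continuous_on_mult *)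
qed

text \<open>On the open element the function coincides with a polynomial, whose gradient is continuous
  everywhere, in particular up to the boundary of the element.\<close>

lemma local_space_continuous_grad:
  fixes G :: "real^'n \<Rightarrow> real^'n" and v :: "real^'n \<Rightarrow> real"
  assumes K: "affine_iso G" and v: "v \<in> local_space c G p"
  shows "\<exists>\<Gamma>. continuous_on UNIV \<Gamma> \<and>
    (\<forall>x\<in>G ` ref_elem c. v differentiable (at x) \<and> grad v x = \<Gamma> x)"
proof -
  obtain b :: "('n \<Rightarrow> nat) \<Rightarrow> real^'n \<Rightarrow> real"
    where b: "\<And>\<alpha>. real_polynomial_function (b \<alpha>)"
    and W: "\<And>p. local_space c G p = functions_spanned_on (G ` ref_elem c) (exponents c p) b"
    using local_space_eq_functions_spanned_on[OF K, of c] by blast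
  obtain k where k: "\<And>x. x \<in> G ` ref_elem c \<Longrightarrow> v x = (\<Sum>\<alpha>\<in>exponents c p. k \<alpha> * b \<alpha> x)"
    using v by (auto simp: W functions_spanned_on_def)
  define g where "g = (\<lambda>x. \<Sum>\<alpha>\<in>exponents c p. k \<alpha> * b \<alpha> x)"
  have "real_polynomial_function g"
    unfolding g_def
    by (intro real_polynomial_function_sum finite_exponents real_polynomial_function.intros(2,4) b)
  then obtain g' where g': "\<And>x. (g has_derivative g' x) (at x)"
    "\<And>h. continuous_on UNIV (\<lambda>x. g' x h)"
    using real_polynomial_function_C1 by blast
  have v': "(v has_derivative g' x) (at x)" if "x \<in> G ` ref_elem c" for x
    using has_derivative_transform_within_open[OF g'(1) open_affine_image_ref_elem[OF K] that] k
    by (simp add: g_def)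
  show ?thesis
  proof (intro exI[of _ "\<lambda>x. \<chi> i. g' x (axis i 1)"] conjI ballI)
    show "continuous_on UNIV (\<lambda>x. \<chi> i. g' x (axis i 1))"
      using g'(2) by (intro continuous_on_vec_lambda)
    fix x assume x: "x \<in> G ` ref_elem c"
    show "v differentiable (at x)" using v'[OF x] by (auto simp: differentiable_def)
    show "grad v x = (\<chi> i. g' x (axis i 1))"
      using frechet_derivative_at[OF v'[OF x]] by (simp add: grad_def)
  qed
qed

lemma grad_add:
  assumes "v differentiable (at x)" "w differentiable (at x)"
  shows "grad (\<lambda>x. v x + w x) x = grad v x + grad w x"
proof -
  have "((\<lambda>x. v x + w x) has_derivative
      (\<lambda>h. frechet_derivative v (at x) h + frechet_derivative w (at x) h)) (at x)"
    using assms by (intro has_derivative_add) (simp_all flip: frechet_derivative_works)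
  from frechet_derivative_at[OF this, symmetric] show ?thesis
    by (simp add: grad_def vec_eq_iff)
qed

section \<open>Bounds for the convective derivative\<close>

text \<open>The bound \<open>B\<close> ensures that the essential supremum is not \<open>\<infinity>\<close>, which \<open>norm_Linf\<close> would turn
  into \<open>0\<close>.  The value \<open>-\<infinity>\<close>, also turned into \<open>0\<close>, can only occur if \<open>D\<close> is a null set, where
  the claim is vacuous.\<close>

lemma AE_le_norm_Linf:
  fixes a :: "real^'n \<Rightarrow> real^'n"
  assumes a: "a \<in> borel_measurable (lebesgue_on D)" and B: "\<And>x. x \<in> D \<Longrightarrow> norm (a x) \<le> B"
    and D: "D \<in> sets lebesgue"
  shows "AE x in lebesgue_on D. norm (a x) \<le> norm_Linf D a"
proof -
  define s where "s = esssup (lebesgue_on D) (\<lambda>x. ereal (norm (a x)))"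
  have "s \<le> ereal B"
    unfolding s_def using a B by (intro esssup_I AE_I2) auto
  then have "s \<noteq> \<infinity>" by auto
  moreover have AE: "AE x in lebesgue_on D. ereal (norm (a x)) \<le> s"
    unfolding s_def by (rule esssup_AE)
  ultimately show ?thesis
    unfolding norm_Linf_def s_def[symmetric]
    by (cases s) (use AE in auto)
qed

lemma norm_L2_scale_power2:
  fixes f :: "real^'n \<Rightarrow> real"
  assumes "0 \<le> t" "D \<in> sets lebesgue"
  shows "(norm_L2 D (\<lambda>x. sqrt t * f x))\<^sup>2 = t * (norm_L2 D f)\<^sup>2"
  using assms by (simp add: norm_L2_power2 power_mult_distrib)

lemma norm_L2_convective_deriv_le:
  fixes a :: "real^'n \<Rightarrow> real^'n" and v :: "real^'n \<Rightarrow> real"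
  assumes D: "open D" "bounded D"
    and A: "continuous_on (closure D) A" "\<And>x. x \<in> D \<Longrightarrow> a x = A x"
    and \<Gamma>: "continuous_on UNIV \<Gamma>" "\<And>x. x \<in> D \<Longrightarrow> grad v x = \<Gamma> x"
  shows "(norm_L2 D (convective_deriv a v))\<^sup>2 \<le> (norm_Linf D a)\<^sup>2 * (seminorm_H1 D v)\<^sup>2"
proof -
  have Dm: "D \<in> sets lebesgue" using D by (simp add: lmeasurable_open fmeasurableD)
  have \<Gamma>c: "continuous_on (closure D) \<Gamma>" using \<Gamma>(1) subset_UNIV by (rule continuous_on_subset)
  have "bounded (A ` closure D)"
    using A(1) D by (simp add: compact_continuous_image compact_imp_bounded)
  then obtain B where B: "\<And>x. x \<in> closure D \<Longrightarrow> norm (A x) \<le> B"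
    by (auto simp: bounded_iff)
  have "A \<in> borel_measurable (lebesgue_on D)"
    using continuous_on_subset[OF A(1) closure_subset] Dm
    by (rule continuous_imp_measurable_on_sets_lebesgue)
  moreover have "a \<in> borel_measurable (lebesgue_on D) \<longleftrightarrow> A \<in> borel_measurable (lebesgue_on D)"
    using A(2) by (intro measurable_cong) auto
  ultimately have am: "a \<in> borel_measurable (lebesgue_on D)" by simp
  have AE: "AE x in lebesgue_on D. norm (a x) \<le> norm_Linf D a"
  proof (rule AE_le_norm_Linf[OF am _ Dm])
    fix x assume x: "x \<in> D"
    then have "x \<in> closure D" using closure_subset[of D] by auto
    then show "norm (a x) \<le> B" using B A(2)[OF x] by simp
  qed
  have conv: "square_integrable (lebesgue_on D) (convective_deriv a v)"
    by (rule square_integrable_lebesgue_on[OF D, of "\<lambda>x. A x \<bullet> \<Gamma> x"])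
       (simp_all add: continuous_on_inner A \<Gamma>c \<Gamma>(2) convective_deriv_def)
  have gr: "square_integrable (lebesgue_on D) (\<lambda>x. norm (grad v x))"
    by (rule square_integrable_lebesgue_on[OF D, of "\<lambda>x. norm (\<Gamma> x)"])
       (simp_all add: continuous_on_norm \<Gamma>c \<Gamma>(2))
  have "(\<integral>x. (convective_deriv a v x)\<^sup>2 \<partial>lebesgue_on D)
      \<le> (\<integral>x. (norm_Linf D a)\<^sup>2 * (norm (grad v x))\<^sup>2 \<partial>lebesgue_on D)"
  proof (rule integral_mono_AE)
    show "AE x in lebesgue_on D.
        (convective_deriv a v x)\<^sup>2 \<le> (norm_Linf D a)\<^sup>2 * (norm (grad v x))\<^sup>2"
      using AE
    proof eventually_elim
      case (elim x)
      have "\<bar>convective_deriv a v x\<bar> \<le> norm (a x) * norm (grad v x)"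
        unfolding convective_deriv_def by (rule Cauchy_Schwarz_ineq2)
      also have "\<dots> \<le> norm_Linf D a * norm (grad v x)"
        using elim by (intro mult_right_mono) auto
      finally have "\<bar>convective_deriv a v x\<bar>\<^sup>2 \<le> (norm_Linf D a * norm (grad v x))\<^sup>2"
        by (intro power_mono) auto
      then show ?case by (simp add: power_mult_distrib)
    qed
  qed (use conv gr in \<open>auto simp: square_integrable_def\<close>)
  then show ?thesis by (simp add: seminorm_H1_def norm_L2_power2[OF Dm])
qed

text \<open>The heart of the proof: the distance of \<open>f\<close> to any member \<open>z\<close> of the local space bounds what
  the projection loses.\<close>

lemma norm_L2_le_proj_disc:
  fixes F :: "nat \<Rightarrow> real^'n \<Rightarrow> real^'n"
  assumes K: "affine_iso (F K)" and D: "bounded (elem c F K)"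
    and f: "square_integrable (lebesgue_on (elem c F K)) f"
    and z: "z \<in> local_space c (F K) pf"
  shows "(norm_L2 (elem c F K) f)\<^sup>2
    \<le> (norm_L2 (elem c F K) (\<lambda>x. f x - z x))\<^sup>2 + (norm_L2 (elem c F K) (proj_disc c F pf K f))\<^sup>2"
proof -
  note opn = open_affine_image_ref_elem[OF K, of c, folded elem_def]
  obtain b :: "('n \<Rightarrow> nat) \<Rightarrow> real^'n \<Rightarrow> real"
    where b: "\<And>\<alpha>. real_polynomial_function (b \<alpha>)"
    and W: "\<And>p. local_space c (F K) p = functions_spanned_on (elem c F K) (exponents c p) b"
    using local_space_eq_functions_spanned_on[OF K, of c] unfolding elem_def by blast
  have sq: "square_integrable (lebesgue_on (elem c F K)) (b \<alpha>)" for \<alpha>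
    using b[of \<alpha>] by (intro square_integrable_lebesgue_on[OF opn D _ refl])
      (simp add: continuous_on_polymonial_function real_polynomial_function_eq)
  show ?thesis
    unfolding proj_disc_def
    by (rule norm_L2_le_L2_projection[OF _ finite_exponents sq W f z])
      (use opn D in \<open>simp add: lmeasurable_open fmeasurableD\<close>)
qed

section \<open>The stability estimate\<close>

theorem lemma4p4:
  fixes \<Omega> :: "(real^'n) set" and c :: cell and p pf :: nat
    and \<sigma> Cinv Cart C\<tau> :: real
  assumes "CARD('n) \<in> {2, 3}"
    and "polyhedral_domain \<Omega>"
    and "p \<ge> 1"
    and "\<sigma> > 0" and "Cinv > 0" and "Cart > 0" and "C\<tau> > 0"
  shows "\<exists>C_SUPG > (0::real).
    \<forall>(N::nat) (F :: nat \<Rightarrow> real^'n \<Rightarrow> real^'n) (a :: real^'n \<Rightarrow> real^'n)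
      (\<kappa>::real) (\<kappa>art :: nat \<Rightarrow> real).
      conforming_mesh c \<Omega> N F \<longrightarrow>
      shape_regular c \<sigma> N F \<longrightarrow>
      smooth_upto_boundary \<Omega> a \<longrightarrow>
      (\<forall>x\<in>\<Omega>. divergence a x = 0) \<longrightarrow>
      \<kappa> > 0 \<longrightarrow>
      (\<forall>K\<in>{1..N}. \<kappa>art K \<ge> 0) \<longrightarrow>
      ((\<forall>vb\<in>V_bar c \<Omega> N F p. \<forall>v'\<in>V_disc c N F pf.
          convective_deriv a (\<lambda>x. vb x + v' x) \<in> V_disc c N F pf)
       \<or>
       ((\<forall>vb\<in>V_bar c \<Omega> N F p. convective_deriv a vb \<in> V_disc c N F pf) \<and>
        (\<forall>K\<in>{1..N}. \<kappa>art K =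
          Cart * inverse (rate Cinv \<kappa> a (elem c F K)) * (norm_Linf (elem c F K) a)\<^sup>2) \<and>
        (\<forall>vb\<in>V_bar c \<Omega> N F p. \<forall>v'\<in>V_disc c N F pf. \<forall>K\<in>{1..N}. \<forall>w\<in>{vb, v'}.
          inverse_inequalities Cinv (elem c F K) w))) \<longrightarrow>
      (\<forall>vb\<in>V_bar c \<Omega> N F p. \<forall>v'\<in>V_disc c N F pf. \<forall>K\<in>{1..N}.
        let D = elem c F K; \<tau> = tau C\<tau> Cinv \<kappa> a D;
            f = convective_deriv a (\<lambda>x. vb x + v' x)
        in (norm_L2 D (\<lambda>x. sqrt \<tau> * f x))\<^sup>2
           \<le> C_SUPG * (\<kappa>art K * (seminorm_H1 D v')\<^sup>2
                + (norm_L2 D (\<lambda>x. sqrt \<tau> * proj_disc c F pf K f x))\<^sup>2))"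
proof (intro exI[of _ "max 1 (C\<tau> / Cart)"] conjI allI impI ballI)
  show "0 < max 1 (C\<tau> / Cart)" by simp
  fix N :: nat and F :: "nat \<Rightarrow> real^'n \<Rightarrow> real^'n" and a :: "real^'n \<Rightarrow> real^'n"
    and \<kappa> :: real and \<kappa>art :: "nat \<Rightarrow> real" and vb v' :: "real^'n \<Rightarrow> real" and K :: nat
  assume mesh: "conforming_mesh c \<Omega> N F" and smooth: "smooth_upto_boundary \<Omega> a"
    and \<kappa>: "\<kappa> > 0" and \<kappa>art: "\<forall>K\<in>{1..N}. \<kappa>art K \<ge> 0"
    and vb: "vb \<in> V_bar c \<Omega> N F p" and v': "v' \<in> V_disc c N F pf" and K: "K \<in> {1..N}"
    and C: "(\<forall>vb\<in>V_bar c \<Omega> N F p. \<forall>v'\<in>V_disc c N F pf.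
          convective_deriv a (\<lambda>x. vb x + v' x) \<in> V_disc c N F pf)
       \<or>
       ((\<forall>vb\<in>V_bar c \<Omega> N F p. convective_deriv a vb \<in> V_disc c N F pf) \<and>
        (\<forall>K\<in>{1..N}. \<kappa>art K =
          Cart * inverse (rate Cinv \<kappa> a (elem c F K)) * (norm_Linf (elem c F K) a)\<^sup>2) \<and>
        (\<forall>vb\<in>V_bar c \<Omega> N F p. \<forall>v'\<in>V_disc c N F pf. \<forall>K\<in>{1..N}. \<forall>w\<in>{vb, v'}.
          inverse_inequalities Cinv (elem c F K) w))"
  define D where "D = elem c F K"
  define \<tau> where "\<tau> = tau C\<tau> Cinv \<kappa> a D"
  define f where "f = convective_deriv a (\<lambda>x. vb x + v' x)"
  define P where "P = proj_disc c F pf K f"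
  have iso: "affine_iso (F K)" and sub: "D \<subseteq> \<Omega>"
    using mesh K by (auto simp: conforming_mesh_def D_def)
  have D: "open D" "bounded D"
    using open_affine_image_ref_elem[OF iso, of c] sub assms(2) bounded_subset
    by (auto simp: D_def elem_def polyhedral_domain_def)
  have Dm: "D \<in> sets lebesgue" using D by (simp add: lmeasurable_open fmeasurableD)
  have "0 \<le> Cinv * \<kappa> / (diameter D)\<^sup>2" using \<kappa> assms(5) by simp
  then have "0 \<le> rate Cinv \<kappa> a D" by (simp add: rate_def max.coboundedI2)
  then have \<tau>: "0 \<le> \<tau>" using assms(7) by (simp add: \<tau>_def tau_def)
  obtain E :: "'n list \<Rightarrow> real^'n \<Rightarrow> real^'n"
    where E: "\<And>x. x \<in> \<Omega> \<Longrightarrow> E [] x = a x" "\<And>js. continuous_on (closure \<Omega>) (E js)"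
    using smooth unfolding smooth_upto_boundary_def by blast
  define A where "A = E []"
  have A: "continuous_on (closure D) A" "\<And>x. x \<in> D \<Longrightarrow> a x = A x"
    using continuous_on_subset[OF E(2) closure_mono[OF sub]] E(1) sub by (auto simp: A_def)
  have vbK: "vb \<in> local_space c (F K) p" and v'K: "v' \<in> local_space c (F K) pf"
    using vb v' K by (auto simp: V_bar_def V_disc_def)
  obtain \<Gamma> where \<Gamma>: "continuous_on UNIV \<Gamma>" "\<And>x. x \<in> D \<Longrightarrow> vb differentiable (at x)"
    "\<And>x. x \<in> D \<Longrightarrow> grad vb x = \<Gamma> x"
    using local_space_continuous_grad[OF iso vbK] unfolding D_def elem_def by blast
  obtain \<Gamma>' where \<Gamma>': "continuous_on UNIV \<Gamma>'" "\<And>x. x \<in> D \<Longrightarrow> v' differentiable (at x)"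
    "\<And>x. x \<in> D \<Longrightarrow> grad v' x = \<Gamma>' x"
    using local_space_continuous_grad[OF iso v'K] unfolding D_def elem_def by blast
  have f_split: "f x = convective_deriv a vb x + convective_deriv a v' x" if "x \<in> D" for x
    using grad_add[OF \<Gamma>(2) \<Gamma>'(2)] that by (simp add: f_def convective_deriv_def inner_add_right)
  have f: "square_integrable (lebesgue_on D) f"
  proof (rule square_integrable_lebesgue_on[OF D])
    show "continuous_on (closure D) (\<lambda>x. A x \<bullet> \<Gamma> x + A x \<bullet> \<Gamma>' x)"
      by (intro continuous_on_add continuous_on_inner A(1)
          continuous_on_subset[OF \<Gamma>(1)] continuous_on_subset[OF \<Gamma>'(1)] subset_UNIV)
    show "f x = A x \<bullet> \<Gamma> x + A x \<bullet> \<Gamma>' x" if "x \<in> D" for x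
      using that by (simp add: f_split convective_deriv_def A \<Gamma> \<Gamma>')
  qed
  have proj: "(norm_L2 D f)\<^sup>2 \<le> (norm_L2 D (\<lambda>x. f x - z x))\<^sup>2 + (norm_L2 D P)\<^sup>2"
    if "z \<in> V_disc c N F pf" for z
  proof -
    have "z \<in> local_space c (F K) pf" using that K by (simp add: V_disc_def)
    then show ?thesis
      using norm_L2_le_proj_disc[of F K c f z pf] iso D(2) f unfolding D_def P_def by blast
  qed
  have "\<tau> * (norm_L2 D f)\<^sup>2 \<le> C\<tau> / Cart * (\<kappa>art K * (seminorm_H1 D v')\<^sup>2) + \<tau> * (norm_L2 D P)\<^sup>2"
    using C
  proof (elim disjE conjE)
    assume "\<forall>vb\<in>V_bar c \<Omega> N F p. \<forall>v'\<in>V_disc c N F pf.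
      convective_deriv a (\<lambda>x. vb x + v' x) \<in> V_disc c N F pf"
    then have "f \<in> V_disc c N F pf" using vb v' by (simp add: f_def)
    then have "(norm_L2 D f)\<^sup>2 \<le> (norm_L2 D P)\<^sup>2" using proj[of f] by (simp add: norm_L2_def)
    then have "\<tau> * (norm_L2 D f)\<^sup>2 \<le> \<tau> * (norm_L2 D P)\<^sup>2" using \<tau> by (rule mult_left_mono)
    moreover have "0 \<le> C\<tau> / Cart * (\<kappa>art K * (seminorm_H1 D v')\<^sup>2)" using assms(6,7) \<kappa>art K by simp
    ultimately show ?thesis by linarith
  next
    \<comment> \<open>Approximate \<open>f\<close> by \<open>a \<bullet> \<nabla>vb\<close>, so that \<open>a \<bullet> \<nabla>v'\<close> remains.\<close>
    assume V: "\<forall>vb\<in>V_bar c \<Omega> N F p. convective_deriv a vb \<in> V_disc c N F pf"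
      and \<kappa>art_eq: "\<forall>K\<in>{1..N}. \<kappa>art K =
          Cart * inverse (rate Cinv \<kappa> a (elem c F K)) * (norm_Linf (elem c F K) a)\<^sup>2"
    have "(norm_L2 D (\<lambda>x. f x - convective_deriv a vb x))\<^sup>2 = (norm_L2 D (convective_deriv a v'))\<^sup>2"
      unfolding norm_L2_power2[OF Dm]
      by (rule Bochner_Integration.integral_cong) (auto simp: f_split)
    also have "\<dots> \<le> (norm_Linf D a)\<^sup>2 * (seminorm_H1 D v')\<^sup>2"
      by (rule norm_L2_convective_deriv_le[OF D A \<Gamma>'(1,3)])
    finally have "(norm_L2 D f)\<^sup>2 \<le> (norm_Linf D a)\<^sup>2 * (seminorm_H1 D v')\<^sup>2 + (norm_L2 D P)\<^sup>2"
      using proj[of "convective_deriv a vb"] V vb by fastforce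
    then have "\<tau> * (norm_L2 D f)\<^sup>2
        \<le> \<tau> * ((norm_Linf D a)\<^sup>2 * (seminorm_H1 D v')\<^sup>2 + (norm_L2 D P)\<^sup>2)"
      using \<tau> by (rule mult_left_mono)
    \<comment> \<open>The factor \<open>inverse (rate \<dots>)\<close> cancels without being evaluated.\<close>
    moreover have "\<tau> * (norm_Linf D a)\<^sup>2 = C\<tau> / Cart * \<kappa>art K"
      using \<kappa>art_eq K assms(6) by (simp add: \<tau>_def tau_def D_def)
    then have "\<tau> * ((norm_Linf D a)\<^sup>2 * (seminorm_H1 D v')\<^sup>2 + (norm_L2 D P)\<^sup>2)
        = C\<tau> / Cart * (\<kappa>art K * (seminorm_H1 D v')\<^sup>2) + \<tau> * (norm_L2 D P)\<^sup>2"
      by (simp add: distrib_left flip: mult.assoc)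
    ultimately show ?thesis by linarith
  qed
  also have "\<dots> \<le> max 1 (C\<tau> / Cart) * (\<kappa>art K * (seminorm_H1 D v')\<^sup>2)
      + max 1 (C\<tau> / Cart) * (\<tau> * (norm_L2 D P)\<^sup>2)"
  proof (rule add_mono)
    show "C\<tau> / Cart * (\<kappa>art K * (seminorm_H1 D v')\<^sup>2)
        \<le> max 1 (C\<tau> / Cart) * (\<kappa>art K * (seminorm_H1 D v')\<^sup>2)"
      using \<kappa>art K by (intro mult_right_mono) auto
    show "\<tau> * (norm_L2 D P)\<^sup>2 \<le> max 1 (C\<tau> / Cart) * (\<tau> * (norm_L2 D P)\<^sup>2)"
      using \<tau> mult_right_mono[of 1 "max 1 (C\<tau> / Cart)" "\<tau> * (norm_L2 D P)\<^sup>2"] by simp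
  qed
  finally show "let D = elem c F K; \<tau> = tau C\<tau> Cinv \<kappa> a D;
            f = convective_deriv a (\<lambda>x. vb x + v' x)
        in (norm_L2 D (\<lambda>x. sqrt \<tau> * f x))\<^sup>2
           \<le> max 1 (C\<tau> / Cart) * (\<kappa>art K * (seminorm_H1 D v')\<^sup>2
                + (norm_L2 D (\<lambda>x. sqrt \<tau> * proj_disc c F pf K f x))\<^sup>2)"
    unfolding Let_def D_def[symmetric] \<tau>_def[symmetric] f_def[symmetric] P_def[symmetric]
      norm_L2_scale_power2[OF \<tau> Dm] distrib_left .
qed

end
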